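(* For any integer $n\ge 2$, there exists a set system $(X,\mathcal{F})$ with $|\mathcal{F}|=2n$ and $|X|=4n(n-1)$, together with a partition $(\mathcal{F}_1,\ldots,\mathcal{F}_n)$ of $\mathcal{F}$ with $|\mathcal{F}_1|=\cdots=|\mathcal{F}_n|=2$, satisfying the following properties: (1) for any $\mathcal{S}\subseteq\mathcal{F}$ satisfying $|\mathcal{S}\cap\mathcal{F}_i|=1$ for each $i=1,\ldots,n$, we have $|\bigcap_{F\in\mathcal{S}}F|=n(n-1)$; and (2) for any $\mathcal{S}\subseteq\mathcal{F}$ with $|\mathcal{S}|=n$ such that $|\mathcal{S}\cap\mathcal{F}_i|\neq 1$ for some $i$, we have $|\bigcap_{F\in\mathcal{S}}F|<n(n-1)$.
   Context: A set system is a pair $(X,\mathcal{F})$ where $X$ is a non-empty (finite) ground set and $\mathcal{F}\subseteq 2^X$ is a collection of subsets of $X$. *)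

theory Defs
  imports Main "HOL-Library.Disjoint_Sets"
begin

definition set_system :: "'a set \<Rightarrow> 'a set set \<Rightarrow> bool" where
  "set_system X F \<longleftrightarrow> finite X \<and> X \<noteq> {} \<and> F \<subseteq> Pow X"

(* The library's partition_on describes an unordered partition; here the parts are indexed.
   The parts are required to be nonempty, as in partition_on. *)
definition indexed_partition :: "'i set \<Rightarrow> 'a set \<Rightarrow> ('i \<Rightarrow> 'a set) \<Rightarrow> bool" where
  "indexed_partition I A P \<longleftrightarrow>
     (\<Union>i\<in>I. P i) = A \<and> disjoint_family_on P I \<and> (\<forall>i\<in>I. P i \<noteq> {})"

end

theory Submission
  imports Defs "HOL-Library.Nat_Bijection"
begin

text \<open>
  Think of the sets as \<open>2n\<close> points in \<open>n\<close> groups of two, and let the ground set consist of the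
  ordered pairs of points in distinct groups; the set belonging to a point consists of the pairs
  avoiding it. The intersection over a set \<open>A\<close> of \<open>n\<close> points then consists of the ordered pairs
  from the complement of \<open>A\<close> whose groups differ. There are \<open>n(n - 1)\<close> ordered pairs of distinct
  points in the complement, and all of them are counted iff no group lies inside the complement,
  i.e. iff \<open>A\<close> is a transversal.
\<close>

text \<open>The grouping map is a parameter so that \<open>cross_pairs id B\<close>, the
  off-diagonal pairs of \<open>B\<close>, is available as the bound to which
  \<open>cross_pairs g B\<close> is compared.\<close>

definition cross_pairs :: "('a \<Rightarrow> 'b) \<Rightarrow> 'a set \<Rightarrow> ('a \<times> 'a) set" where
  "cross_pairs g B = {(u, v) \<in> B \<times> B. g u \<noteq> g v}"

lemma finite_cross_pairs: "finite B \<Longrightarrow> finite (cross_pairs g B)"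
  unfolding cross_pairs_def by (rule finite_subset[of _ "B \<times> B"]) auto

lemma card_off_diagonal:
  assumes "finite B"
  shows "card (cross_pairs id B) = card B * (card B - 1)"
proof -
  have "cross_pairs id B = (SIGMA u:B. B - {u})"
    by (auto simp: cross_pairs_def)
  then show ?thesis
    using assms by simp
qed

lemma card_cross_pairs_inj_on:
  assumes "finite B" "inj_on g B"
  shows "card (cross_pairs g B) = card B * (card B - 1)"
proof -
  have "cross_pairs g B = cross_pairs id B"
    using assms(2) by (auto simp: cross_pairs_def inj_on_def)
  then show ?thesis
    using card_off_diagonal[OF assms(1)] by simp
qed

text \<open>A collision \<open>g u = g v\<close> with distinct \<open>u\<close>, \<open>v\<close> in
  \<open>B\<close> removes \<open>(u, v)\<close> from the off-diagonal pairs, so the inclusion in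
  \<open>cross_pairs id B\<close> is strict.\<close>

lemma card_cross_pairs_less:
  assumes "finite B" "\<not> inj_on g B"
  shows "card (cross_pairs g B) < card B * (card B - 1)"
proof -
  have "cross_pairs g B \<subset> cross_pairs id B"
    using assms(2) by (auto simp: cross_pairs_def inj_on_def)
  then show ?thesis
    using psubset_card_mono[OF finite_cross_pairs] card_off_diagonal assms(1) by metis
qed

text \<open>This turns the condition of one point per group into bijectivity of the grouping map:
  fibers with at most one point give injectivity, nonempty fibers give surjectivity.\<close>

lemma bij_betw_iff_card_fiber:
  assumes "g ` B \<subseteq> I"
  shows "bij_betw g B I \<longleftrightarrow> (\<forall>i\<in>I. card {b \<in> B. g b = i} = 1)"
proof
  assume bij: "bij_betw g B I"
  show "\<forall>i\<in>I. card {b \<in> B. g b = i} = 1"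
  proof
    fix i assume "i \<in> I"
    then obtain b where "b \<in> B" "g b = i"
      using bij by (auto simp: bij_betw_def)
    then have "{b \<in> B. g b = i} = {b}"
      using bij by (auto simp: bij_betw_def inj_on_def)
    then show "card {b \<in> B. g b = i} = 1"
      by simp
  qed
next
  assume fiber: "\<forall>i\<in>I. card {b \<in> B. g b = i} = 1"
  have "inj_on g B"
  proof (rule inj_onI)
    fix x y assume xy: "x \<in> B" "y \<in> B" "g x = g y"
    then have "card {b \<in> B. g b = g x} = 1"
      using fiber assms by (simp add: image_subset_iff)
    then obtain c where "{b \<in> B. g b = g x} = {c}"
      by (rule card_1_singletonE)
    then have "x \<in> {c}" "y \<in> {c}"
      using xy by fastforce+
    then show "x = y"
      by simp
  qed
  moreover have "i \<in> g ` B" if "i \<in> I" for i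
  proof -
    obtain c where "{b \<in> B. g b = i} = {c}"
      using fiber[rule_format, OF \<open>i \<in> I\<close>] by (rule card_1_singletonE)
    then have "c \<in> B" "g c = i"
      by auto
    then show ?thesis
      by blast
  qed
  ultimately show "bij_betw g B I"
    using assms by (auto simp: bij_betw_def)
qed

text \<open>Starting at 2 makes \<open>p div 2\<close> run over \<open>{1..n}\<close>, the index set
  of the partition.\<close>

definition points :: "nat \<Rightarrow> nat set" where
  "points n = {2..<2 * n + 2}"

definition same_group :: "nat \<Rightarrow> nat set" where
  "same_group i = {2 * i, 2 * i + 1}"

abbreviation group_of :: "nat \<Rightarrow> nat" where
  "group_of p \<equiv> p div 2"

text \<open>The encoding turns pairs into elements of a ground set of naturals; being injective, it
  preserves cardinalities and nonempty intersections.\<close>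

definition avoiding :: "nat \<Rightarrow> nat \<Rightarrow> nat set" where
  "avoiding n p = prod_encode ` cross_pairs group_of (points n - {p})"

lemma finite_points [simp]: "finite (points n)"
  and card_points [simp]: "card (points n) = 2 * n"
  by (simp_all add: points_def)

lemma group_of_points: "group_of ` points n \<subseteq> {1..n}"
  by (auto simp: points_def)

lemma same_group_eq: "same_group i = {p. group_of p = i}"
  by (auto simp: same_group_def)

lemma same_group_subset: "i \<in> {1..n} \<Longrightarrow> same_group i \<subseteq> points n"
  by (auto simp: same_group_def points_def)

lemma card_same_group [simp]: "card (same_group i) = 2"
  by (simp add: same_group_def)

text \<open>Each of the \<open>2 * n\<close> first components can be paired with the
  \<open>2 * n - 2\<close> points outside its group.\<close>

lemma card_cross_pairs_points:
  "card (cross_pairs group_of (points n)) = 4 * n * (n - 1)"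
proof -
  have "cross_pairs group_of (points n) = (SIGMA u:points n. points n - same_group (group_of u))"
    by (auto simp: cross_pairs_def same_group_eq)
  moreover have "card (points n - same_group (group_of u)) = 2 * n - 2" if "u \<in> points n" for u
  proof -
    have "same_group (group_of u) \<subseteq> points n"
      using that group_of_points by (intro same_group_subset) blast
    then show ?thesis
      by (subst card_Diff_subset) (auto intro: finite_subset)
  qed
  ultimately have "card (cross_pairs group_of (points n)) = 2 * n * (2 * n - 2)"
    by simp
  also have "\<dots> = 4 * n * (n - 1)"
    by (simp add: diff_mult_distrib2)
  finally show ?thesis .
qed

lemma Inter_avoiding:
  assumes "A \<noteq> {}"
  shows "\<Inter> (avoiding n ` A) = prod_encode ` cross_pairs group_of (points n - A)"
proof -
  obtain a where "a \<in> A"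
    using assms by blast
  then have "\<Inter> (avoiding n ` A) = prod_encode ` (\<Inter>p\<in>A. cross_pairs group_of (points n - {p}))"
    unfolding avoiding_def
    by (intro image_INT[OF inj_prod_encode[of UNIV], symmetric]) auto
  also have "(\<Inter>p\<in>A. cross_pairs group_of (points n - {p})) = cross_pairs group_of (points n - A)"
    using assms by (auto simp: cross_pairs_def)
  finally show ?thesis .
qed

text \<open>For distinct \<open>p\<close> and \<open>q\<close>, some pair contains \<open>p\<close>
  and avoids \<open>q\<close>: as \<open>n \<ge> 2\<close> there is a group other than that of
  \<open>p\<close>, and at least one of its two points differs from \<open>q\<close>.\<close>

lemma inj_on_avoiding:
  assumes "n \<ge> 2"
  shows "inj_on (avoiding n) (points n)"
proof (rule inj_onI, rule ccontr)
  fix p q assume pq: "p \<in> points n" "q \<in> points n" "avoiding n p = avoiding n q" "p \<noteq> q"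
  obtain j where j: "j \<in> {1..n}" "j \<noteq> group_of p"
    using assms by (cases "group_of p = 1") (auto intro: that[of 1] that[of 2])
  obtain r where r: "r \<in> same_group j" "r \<noteq> q"
    by (cases "q = 2 * j") (auto simp: same_group_def)
  have "r \<in> points n"
    using r same_group_subset[OF j(1)] by blast
  moreover have "group_of r \<noteq> group_of p"
    using r j by (simp add: same_group_eq)
  ultimately have "(p, r) \<in> cross_pairs group_of (points n - {q})"
    using pq r by (auto simp: cross_pairs_def)
  then have "(p, r) \<in> cross_pairs group_of (points n - {p})"
    using pq(3) unfolding avoiding_def by (simp add: inj_image_eq_iff[OF inj_prod_encode])
  then show False
    by (simp add: cross_pairs_def)
qed

text \<open>As every group has two points, \<open>A\<close> meets it once iff its complement does.\<close>

lemma transversal_iff_compl: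
  assumes "A \<subseteq> points n"
  shows "(\<forall>i\<in>{1..n}. card (A \<inter> same_group i) = 1) \<longleftrightarrow>
    bij_betw group_of (points n - A) {1..n}"
proof -
  have "card (A \<inter> same_group i) = 1 \<longleftrightarrow> card {b \<in> points n - A. group_of b = i} = 1"
    if "i \<in> {1..n}" for i
  proof -
    have "{b \<in> points n - A. group_of b = i} = same_group i - A"
      using same_group_subset[OF that] by (auto simp: same_group_eq)
    moreover have "card (same_group i - A) = 2 - card (A \<inter> same_group i)"
      using card_Diff_subset_Int[of "same_group i" A] by (simp add: same_group_def Int_commute)
    ultimately show ?thesis
      by auto
  qed
  then show ?thesis
    using group_of_points by (subst bij_betw_iff_card_fiber) auto
qed

theorem lemma3p7:
  fixes n :: nat
  assumes "n \<ge> 2"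
  shows "\<exists>(X :: nat set) (F :: nat set set) (P :: nat \<Rightarrow> nat set set).
    set_system X F \<and> card F = 2 * n \<and> card X = 4 * n * (n - 1) \<and>
    indexed_partition {1..n} F P \<and> (\<forall>i\<in>{1..n}. card (P i) = 2) \<and>
    (\<forall>S\<subseteq>F. (\<forall>i\<in>{1..n}. card (S \<inter> P i) = 1) \<longrightarrow> card (\<Inter>S) = n * (n - 1)) \<and>
    (\<forall>S\<subseteq>F. card S = n \<and> (\<exists>i\<in>{1..n}. card (S \<inter> P i) \<noteq> 1) \<longrightarrow> card (\<Inter>S) < n * (n - 1))"
proof -
  define X where "X = prod_encode ` cross_pairs group_of (points n)"
  define F where "F = avoiding n ` points n"
  define P where "P i = avoiding n ` same_group i" for i
  note inj = inj_on_avoiding[OF assms]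
  \<comment> \<open>By injectivity of \<open>avoiding n\<close>, counting in subfamilies of
    \<open>F\<close> reduces to counting in sets of points.\<close>
  have sub: "A \<subseteq> points n \<Longrightarrow> card (avoiding n ` A) = card A" for A
    using inj by (meson card_image inj_on_subset)
  have Int_P: "card (avoiding n ` A \<inter> P i) = card (A \<inter> same_group i)"
    if "A \<subseteq> points n" "i \<in> {1..n}" for A i
    using that same_group_subset[OF that(2)] unfolding P_def
    by (subst inj_on_image_Int[OF inj, symmetric]) (auto intro!: sub)
  have card_Inter: "card (\<Inter> (avoiding n ` A)) = card (cross_pairs group_of (points n - A))"
    if "A \<noteq> {}" for A
    using Inter_avoiding[OF that] by (simp add: card_image[OF inj_prod_encode])
  have card_X: "card X = 4 * n * (n - 1)"
    unfolding X_def using card_cross_pairs_points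
    by (simp add: card_image[OF inj_prod_encode])
  have "X \<noteq> {}"
    using card_X assms by auto
  moreover have "F \<subseteq> Pow X"
    by (auto simp: F_def X_def avoiding_def cross_pairs_def)
  ultimately have "set_system X F"
    by (simp add: set_system_def X_def finite_cross_pairs)
  moreover have "card F = 2 * n"
    unfolding F_def by (simp add: sub)
  moreover have "indexed_partition {1..n} F P"
    unfolding indexed_partition_def
  proof (intro conjI)
    have "(\<Union>i\<in>{1..n}. same_group i) = points n"
      using group_of_points same_group_subset by (fastforce simp: same_group_eq)
    then show "(\<Union>i\<in>{1..n}. P i) = F"
      unfolding P_def F_def by (metis image_UN)
    show "disjoint_family_on P {1..n}"
      unfolding disjoint_family_on_def
    proof (intro ballI impI)
      fix i j assume ij: "i \<in> {1..n}" "j \<in> {1..n}" "i \<noteq> j"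
      then have "P i \<inter> P j = avoiding n ` (same_group i \<inter> same_group j)"
        unfolding P_def using same_group_subset by (intro inj_on_image_Int[OF inj, symmetric]) auto
      then show "P i \<inter> P j = {}"
        using ij by (auto simp: same_group_eq)
    qed
    show "\<forall>i\<in>{1..n}. P i \<noteq> {}"
      by (simp add: P_def same_group_def)
  qed
  moreover have "\<forall>i\<in>{1..n}. card (P i) = 2"
    unfolding P_def using same_group_subset by (simp add: sub)
  moreover have "card (\<Inter>S) = n * (n - 1)"
    if "S \<subseteq> F" and transversal: "\<forall>i\<in>{1..n}. card (S \<inter> P i) = 1" for S
  proof -
    obtain A where A: "A \<subseteq> points n" "S = avoiding n ` A"
      using \<open>S \<subseteq> F\<close> unfolding F_def by (rule subset_imageE)
    \<comment> \<open>\<open>S\<close> meets \<open>P 1\<close> in one set, so it is nonempty; this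
      excludes \<open>\<Inter>{} = UNIV\<close>.\<close>
    have "A \<noteq> {}"
      using transversal[rule_format, of 1] assms A by auto
    \<comment> \<open>The size of \<open>S\<close> is not assumed here; the bijection itself shows
      that the complement of \<open>A\<close> has \<open>n\<close> points.\<close>
    have bij: "bij_betw group_of (points n - A) {1..n}"
      using transversal A transversal_iff_compl[OF A(1)] Int_P by auto
    then show ?thesis
      using card_Inter[OF \<open>A \<noteq> {}\<close>] A(2) bij_betw_same_card[OF bij]
      by (simp add: card_cross_pairs_inj_on bij_betw_imp_inj_on)
  qed
  moreover have "card (\<Inter>S) < n * (n - 1)"
    if "S \<subseteq> F" "card S = n" and not_transversal: "\<exists>i\<in>{1..n}. card (S \<inter> P i) \<noteq> 1" for S
  proof -
    obtain A where A: "A \<subseteq> points n" "S = avoiding n ` A"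
      using \<open>S \<subseteq> F\<close> unfolding F_def by (rule subset_imageE)
    have card_A: "card A = n"
      using A that(2) sub by simp
    then have "A \<noteq> {}"
      using assms by auto
    have card_compl: "card (points n - A) = n"
      using A card_A by (simp add: card_Diff_subset finite_subset[OF A(1)])
    have "\<not> bij_betw group_of (points n - A) {1..n}"
      using not_transversal A transversal_iff_compl[OF A(1)] Int_P by auto
    moreover have "group_of ` (points n - A) \<subseteq> {1..n}"
      using group_of_points by blast
    \<comment> \<open>An injection of the \<open>n\<close> points of the complement into the
      \<open>n\<close> groups would be onto, so failing to be a bijection forces a
      collision.\<close>
    ultimately have "\<not> inj_on group_of (points n - A)"
      using card_compl card_subset_eq[of "{1..n}" "group_of ` (points n - A)"]
      by (auto simp: bij_betw_def card_image)
    then show ?thesis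
      using card_Inter[OF \<open>A \<noteq> {}\<close>] A(2) card_cross_pairs_less[of "points n - A" group_of]
      by (simp add: card_compl)
  qed
  ultimately show ?thesis
    using card_X by (intro exI[of _ X] exI[of _ F] exI[of _ P]) simp
qed

end
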